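(* Let $q\geq 2$ and let $\gamma$ be an integer. There exists a completely regular code $C$ in $H(3,q)$ with covering radius $1$, eigenvalue $\lambda_2(3,q)=q-3$, parameter $\gamma$ and $\gamma\leq\beta$ if and only if one of the following holds: (1) $\gamma$ is even and $2\leq \gamma\leq q$; (2) $q$ is even and $\frac{q}{2}\leq \gamma\leq q$; (3) $q$ is even, $\gamma$ is odd, $\gamma<\frac{q}{2}$, and Condition 1 holds for $q$ and $\gamma$.
   Context: Let $\mathcal{A}$ be a set of size $q\geq 2$. The Hamming graph $H(n,q)$ has vertex set $\mathcal{A}^n$, two tuples being adjacent iff they differ in exactly one position; it is $n(q-1)$-regular and its eigenvalues are $\lambda_i(n,q)=n(q-1)-qi$, $i=0,\dots,n$. For a $k$-regular graph $\Gamma$, a set $C$ of vertices is a completely regular code with covering radius $1$ if $C$ is a nonempty proper subset of the vertex set and there are integers $\beta$ and $\gamma\geq 1$ such that every vertex of $C$ has exactly $\beta$ neighbours outside $C$ and every vertex outside $C$ has exactly $\gamma$ neighbours in $C$. Its intersection matrix is $\begin{pmatrix}k-\beta&\beta\\ \gamma&k-\gamma\end{pmatrix}$, whose eigenvalues are $k$ and $k-(\beta+\gamma)$; "the code has eigenvalue $\lambda$" (for $\lambda\neq k$) means $k-(\beta+\gamma)=\lambda$. Thus eigenvalue $\lambda_2(3,q)$ means $\beta+\gamma=2q$. Condition 1 (for $q$ and $\gamma$): there exist integers $r,s,t$ with $0<r,s,t<q$ and integers $a,b,c$ with $0<c\leq\min\{q-s,q-t\}$, $0<b\leq \min\{t,q-r\}$,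 $0<a\leq\min\{r,s\}$ such that $cr=a(q-t)$, $b(q-s)=c(q-r)$, $at=bs$, and $\gamma=a+b+c$. *)

theory Defs
  imports Main
begin

text \<open>A graph is given by a vertex set \<open>V\<close> and an adjacency relation \<open>E\<close>; only the
  restriction of \<open>E\<close> to \<open>V\<close> matters.\<close>

definition regular_graph :: "'v set \<Rightarrow> ('v \<Rightarrow> 'v \<Rightarrow> bool) \<Rightarrow> nat \<Rightarrow> bool" where
  "regular_graph V E k \<longleftrightarrow> (\<forall>x\<in>V. finite {y \<in> V. E x y} \<and> card {y \<in> V. E x y} = k)"

definition completely_regular_code_radius1 ::
    "'v set \<Rightarrow> ('v \<Rightarrow> 'v \<Rightarrow> bool) \<Rightarrow> 'v set \<Rightarrow> int \<Rightarrow> int \<Rightarrow> bool" where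
  "completely_regular_code_radius1 V E C \<beta> \<gamma> \<longleftrightarrow>
     C \<noteq> {} \<and> C \<subset> V \<and> \<gamma> \<ge> 1 \<and>
     (\<forall>x\<in>C. int (card {y \<in> V - C. E x y}) = \<beta>) \<and>
     (\<forall>x\<in>V - C. int (card {y \<in> C. E x y}) = \<gamma>)"

text \<open>In a \<open>k\<close>-regular graph, the intersection matrix with rows \<open>(k - \<beta>, \<beta>)\<close> and
  \<open>(\<gamma>, k - \<gamma>)\<close> has the eigenvalues \<open>k\<close> and \<open>k - (\<beta> + \<gamma>)\<close>; the eigenvalue of the code is
  the one other than \<open>k\<close>.\<close>

definition code_has_eigenvalue ::
    "'v set \<Rightarrow> ('v \<Rightarrow> 'v \<Rightarrow> bool) \<Rightarrow> int \<Rightarrow> int \<Rightarrow> int \<Rightarrow> bool" where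
  "code_has_eigenvalue V E \<beta> \<gamma> \<mu> \<longleftrightarrow>
     (\<exists>k. regular_graph V E k \<and> \<mu> \<noteq> int k \<and> int k - (\<beta> + \<gamma>) = \<mu>)"

definition hamming_vertices :: "nat \<Rightarrow> 'a set \<Rightarrow> 'a list set" where
  "hamming_vertices n A = {x. length x = n \<and> set x \<subseteq> A}"

definition hamming_adj :: "nat \<Rightarrow> 'a list \<Rightarrow> 'a list \<Rightarrow> bool" where
  "hamming_adj n x y \<longleftrightarrow> (\<exists>!i. i < n \<and> x ! i \<noteq> y ! i)"

definition hamming_eigenvalue :: "nat \<Rightarrow> nat \<Rightarrow> nat \<Rightarrow> int" where
  "hamming_eigenvalue i n q = int n * (int q - 1) - int q * int i"

lemma hamming_eigenvalue_2_3: "hamming_eigenvalue 2 3 q = int q - 3"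
  by (simp add: hamming_eigenvalue_def)

definition condition1 :: "nat \<Rightarrow> int \<Rightarrow> bool" where
  "condition1 q \<gamma> \<longleftrightarrow>
     (\<exists>r s t a b c :: int.
        0 < r \<and> r < int q \<and> 0 < s \<and> s < int q \<and> 0 < t \<and> t < int q \<and>
        0 < c \<and> c \<le> min (int q - s) (int q - t) \<and>
        0 < b \<and> b \<le> min t (int q - r) \<and>
        0 < a \<and> a \<le> min r s \<and>
        c * r = a * (int q - t) \<and> b * (int q - s) = c * (int q - r) \<and> a * t = b * s \<and>
        \<gamma> = a + b + c)"

end

theory Submission
  imports Defs
begin

text \<open>Counting neighbours line by line, a set with indicator \<open>P\<close> is such a code iff the sizes of its
  intersections with the three lines through any vertex add up to \<open>\<gamma>\<close>, plus \<open>q\<close> if the vertex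
  lies in the set. Summing over all vertices shows that \<open>q\<gamma>\<close> is even.
  If \<open>2\<gamma> < q\<close>, then every line not contained in the code meets it in at most \<open>\<gamma>\<close> points, so every
  point of the code lies on exactly one line contained in the code. The code is therefore a
  disjoint union of three cylinders over sets of pairs, and the line equations say that the
  line counts of these sets take only the value 0 and one constant per coordinate direction. These
  constants are \<open>a, b, c\<close>, the sizes of the supports give \<open>r, s, t\<close>, and oddness of \<open>\<gamma>\<close>
  excludes the degenerate cases. Conversely, the codes are glued from boxes and cylinders over
  biregular relations, which exist by writing the ones of a matrix cyclically.\<close>

section \<open>Counting neighbours in \<open>H(3,q)\<close> along lines\<close>

lemma hamming_vertices_3:
  "hamming_vertices 3 A = {[x, y, z] | x y z. x \<in> A \<and> y \<in> A \<and> z \<in> A}"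
  by (auto simp: hamming_vertices_def numeral_3_eq_3 length_Suc_conv)

lemma hamming_adj_3:
  "hamming_adj 3 [x, y, z] [x', y', z'] \<longleftrightarrow>
     x \<noteq> x' \<and> y = y' \<and> z = z' \<or> x = x' \<and> y \<noteq> y' \<and> z = z' \<or> x = x' \<and> y = y' \<and> z \<noteq> z'"
proof -
  have *: "{i :: nat. i < 3} = {0, 1, 2}" by auto
  have "(\<exists>!i. i < 3 \<and> p i) \<longleftrightarrow> (\<exists>i\<in>{i. i < 3}. p i \<and> (\<forall>j\<in>{i. i < 3}. p j \<longrightarrow> j = i))"
    for p :: "nat \<Rightarrow> bool"
    by blast
  then show ?thesis
    unfolding hamming_adj_def * by simp blast
qed

text \<open>The three lines through a vertex meet only in that vertex, so a vertex of
  \<open>B\<close> is counted three times on the right although it is no neighbour of itself. With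
  \<open>B\<close> arbitrary, the formula serves for a code, for its complement and for the whole
  graph.\<close>

lemma card_hamming_neighbours:
  assumes A: "finite A" and B: "B \<subseteq> hamming_vertices 3 A"
    and xyz: "x \<in> A" "y \<in> A" "z \<in> A"
  shows "finite {w \<in> B. hamming_adj 3 [x, y, z] w}"
    and "card {w \<in> B. hamming_adj 3 [x, y, z] w} + 3 * of_bool ([x, y, z] \<in> B) =
         card {u \<in> A. [u, y, z] \<in> B} + card {u \<in> A. [x, u, z] \<in> B} + card {u \<in> A. [x, y, u] \<in> B}"
proof -
  define S1 S2 S3 where "S1 = {u \<in> A. [u, y, z] \<in> B} - {x}"
    and "S2 = {u \<in> A. [x, u, z] \<in> B} - {y}" and "S3 = {u \<in> A. [x, y, u] \<in> B} - {z}"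
  let ?I1 = "(\<lambda>u. [u, y, z]) ` S1" and ?I2 = "(\<lambda>u. [x, u, z]) ` S2" and ?I3 = "(\<lambda>u. [x, y, u]) ` S3"
  have eq: "{w \<in> B. hamming_adj 3 [x, y, z] w} = ?I1 \<union> ?I2 \<union> ?I3"
  proof (intro equalityI subsetI)
    fix w assume "w \<in> {w \<in> B. hamming_adj 3 [x, y, z] w}"
    then have w: "w \<in> B" "hamming_adj 3 [x, y, z] w" by auto
    with B obtain a b c where abc: "w = [a, b, c]" "a \<in> A" "b \<in> A" "c \<in> A"
      unfolding hamming_vertices_3 by blast
    from w abc show "w \<in> ?I1 \<union> ?I2 \<union> ?I3"
      by (auto simp: hamming_adj_3 S1_def S2_def S3_def)
  qed (auto simp: hamming_adj_3 S1_def S2_def S3_def)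
  have fin: "finite S1" "finite S2" "finite S3"
    using A by (auto simp: S1_def S2_def S3_def)
  show "finite {w \<in> B. hamming_adj 3 [x, y, z] w}"
    unfolding eq using fin by auto
  have "card (?I1 \<union> ?I2 \<union> ?I3) = card (?I1 \<union> ?I2) + card ?I3"
    using fin by (intro card_Un_disjoint) (auto simp: S1_def S2_def S3_def)
  also have "card (?I1 \<union> ?I2) = card ?I1 + card ?I2"
    using fin by (intro card_Un_disjoint) (auto simp: S1_def S2_def S3_def)
  finally have "card {w \<in> B. hamming_adj 3 [x, y, z] w} = card S1 + card S2 + card S3"
    by (simp add: eq card_image inj_on_def)
  moreover have "card {u \<in> A. [u, y, z] \<in> B} = card S1 + of_bool ([x, y, z] \<in> B)"
    using card_Suc_Diff1[of "{u \<in> A. [u, y, z] \<in> B}" x] A xyz by (auto simp: S1_def)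
  moreover have "card {u \<in> A. [x, u, z] \<in> B} = card S2 + of_bool ([x, y, z] \<in> B)"
    using card_Suc_Diff1[of "{u \<in> A. [x, u, z] \<in> B}" y] A xyz by (auto simp: S2_def)
  moreover have "card {u \<in> A. [x, y, u] \<in> B} = card S3 + of_bool ([x, y, z] \<in> B)"
    using card_Suc_Diff1[of "{u \<in> A. [x, y, u] \<in> B}" z] A xyz by (auto simp: S3_def)
  ultimately show "card {w \<in> B. hamming_adj 3 [x, y, z] w} + 3 * of_bool ([x, y, z] \<in> B) =
         card {u \<in> A. [u, y, z] \<in> B} + card {u \<in> A. [x, u, z] \<in> B} + card {u \<in> A. [x, y, u] \<in> B}"
    by simp
qed

lemma regular_hamming_3:
  assumes "finite A" "A \<noteq> {}"
  shows "regular_graph (hamming_vertices 3 A) (hamming_adj 3) k \<longleftrightarrow> k + 3 = 3 * card A"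
proof -
  have "finite {w \<in> hamming_vertices 3 A. hamming_adj 3 v w} \<and>
        card {w \<in> hamming_vertices 3 A. hamming_adj 3 v w} + 3 = 3 * card A"
    if v: "v \<in> hamming_vertices 3 A" for v
  proof -
    from v obtain x y z where xyz: "v = [x, y, z]" "x \<in> A" "y \<in> A" "z \<in> A"
      unfolding hamming_vertices_3 by blast
    from card_hamming_neighbours[OF assms(1) order_refl xyz(2-4)] xyz show ?thesis
      by (simp add: hamming_vertices_def)
  qed
  moreover have "hamming_vertices 3 A \<noteq> {}"
    using assms(2) by (auto simp: hamming_vertices_3)
  ultimately show ?thesis
    unfolding regular_graph_def
    by (metis (no_types, lifting) add_right_cancel ex_in_conv)
qed

section \<open>Codes as solutions of one line-sum equation\<close>

text \<open>\<open>P\<close> is the indicator of the code and \<open>g\<close> is \<gamma>. One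
  equation covers both kinds of vertices: since \<beta> + \<gamma> = 2q, a vertex of the code has
  line sum 3q - \<beta> = q + \<gamma>.\<close>

definition balanced :: "'a set \<Rightarrow> ('a \<Rightarrow> 'a \<Rightarrow> 'a \<Rightarrow> bool) \<Rightarrow> nat \<Rightarrow> bool" where
  "balanced A P g \<longleftrightarrow> (\<forall>x\<in>A. \<forall>y\<in>A. \<forall>z\<in>A.
     card {u \<in> A. P u y z} + card {u \<in> A. P x u z} + card {u \<in> A. P x y u} =
       g + card A * of_bool (P x y z))"

lemma balancedD:
  assumes "balanced A P g" "x \<in> A" "y \<in> A" "z \<in> A"
  shows "card {u \<in> A. P u y z} + card {u \<in> A. P x u z} + card {u \<in> A. P x y u} =
           g + card A * of_bool (P x y z)"
  using assms by (auto simp: balanced_def)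

lemma card_Collect_not:
  assumes "finite A"
  shows "int (card {u \<in> A. \<not> P u}) = int (card A) - int (card {u \<in> A. P u})"
proof -
  have "card A = card {u \<in> A. P u} + card {u \<in> A. \<not> P u}"
    using assms by (subst card_Un_disjoint[symmetric]) (auto intro: arg_cong[of _ _ card])
  then show ?thesis by simp
qed

text \<open>The degree is 3q - 3, so the eigenvalue q - 3 amounts to \<beta> = 2q - \<gamma>. This
  determines \<beta> and turns \<gamma> \<le> \<beta> into \<gamma> \<le> q.\<close>

lemma code_iff_balanced:
  assumes q: "q \<ge> 2" and cA: "card A = q"
  shows "(\<exists>C \<beta>. completely_regular_code_radius1 (hamming_vertices 3 A) (hamming_adj 3) C \<beta> \<gamma> \<and>
            code_has_eigenvalue (hamming_vertices 3 A) (hamming_adj 3) \<beta> \<gamma>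
              (hamming_eigenvalue 2 3 q) \<and> \<gamma> \<le> \<beta>)
     \<longleftrightarrow> 1 \<le> \<gamma> \<and> \<gamma> \<le> int q \<and> (\<exists>P. balanced A P (nat \<gamma>))"
    (is "?L \<longleftrightarrow> ?R")
proof -
  have fin: "finite A" and ne: "A \<noteq> {}"
    using q cA by (auto intro: card_ge_0_finite)
  let ?V = "hamming_vertices 3 A"
  define N where "N C x y z = int (card {u \<in> A. [u, y, z] \<in> C}) + int (card {u \<in> A. [x, u, z] \<in> C})
      + int (card {u \<in> A. [x, y, u] \<in> C})" for C and x y z :: 'a
  have inC: "int (card {w \<in> C. hamming_adj 3 [x, y, z] w}) = N C x y z"
    if "C \<subseteq> ?V" "x \<in> A" "y \<in> A" "z \<in> A" "[x, y, z] \<notin> C" for C x y z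
    using card_hamming_neighbours(2)[OF fin that(1-4)] that(5) by (simp add: N_def)
  have outC: "int (card {w \<in> ?V - C. hamming_adj 3 [x, y, z] w}) = 3 * int q - N C x y z"
    if "C \<subseteq> ?V" "x \<in> A" "y \<in> A" "z \<in> A" "[x, y, z] \<in> C" for C x y z
  proof -
    have "{u \<in> A. [u, y, z] \<in> ?V - C} = {u \<in> A. [u, y, z] \<notin> C}"
      "{u \<in> A. [x, u, z] \<in> ?V - C} = {u \<in> A. [x, u, z] \<notin> C}"
      "{u \<in> A. [x, y, u] \<in> ?V - C} = {u \<in> A. [x, y, u] \<notin> C}"
      using that by (auto simp: hamming_vertices_3)
    then show ?thesis
      using card_hamming_neighbours(2)[OF fin Diff_subset that(2-4), of C] that(5)
      by (simp add: N_def cA card_Collect_not[OF fin])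
  qed
  have eig: "code_has_eigenvalue ?V (hamming_adj 3) \<beta> \<gamma> (hamming_eigenvalue 2 3 q) \<longleftrightarrow>
      \<beta> = 2 * int q - \<gamma>" for \<beta>
  proof -
    have "regular_graph ?V (hamming_adj 3) k \<longleftrightarrow> k = 3 * q - 3" for k
      unfolding regular_hamming_3[OF fin ne] cA using q by auto
    then show ?thesis
      using q by (auto simp: code_has_eigenvalue_def hamming_eigenvalue_2_3 of_nat_diff)
  qed
  show ?thesis
  proof
    assume ?L
    then obtain C \<beta> where C: "completely_regular_code_radius1 ?V (hamming_adj 3) C \<beta> \<gamma>"
      and e: "code_has_eigenvalue ?V (hamming_adj 3) \<beta> \<gamma> (hamming_eigenvalue 2 3 q)" "\<gamma> \<le> \<beta>"
      by blast
    from e have \<beta>: "\<beta> = 2 * int q - \<gamma>" "\<gamma> \<le> int q" by (auto simp: eig)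
    from C have sub: "C \<subseteq> ?V" and \<gamma>: "1 \<le> \<gamma>"
      and b: "\<And>v. v \<in> C \<Longrightarrow> int (card {w \<in> ?V - C. hamming_adj 3 v w}) = \<beta>"
      and c: "\<And>v. v \<in> ?V - C \<Longrightarrow> int (card {w \<in> C. hamming_adj 3 v w}) = \<gamma>"
      by (auto simp: completely_regular_code_radius1_def)
    have "N C x y z = \<gamma> + int q * of_bool ([x, y, z] \<in> C)"
      if xyz: "x \<in> A" "y \<in> A" "z \<in> A" for x y z
    proof (cases "[x, y, z] \<in> C")
      case True
      with outC[OF sub xyz] b[of "[x, y, z]"] \<beta> show ?thesis by simp
    next
      case False
      with inC[OF sub xyz] c[of "[x, y, z]"] xyz show ?thesis by (simp add: hamming_vertices_def)
    qed
    then have "balanced A (\<lambda>x y z. [x, y, z] \<in> C) (nat \<gamma>)"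
      unfolding balanced_def N_def cA using \<gamma>
      by (fastforce simp flip: of_nat_eq_iff[where 'a = int])
    with \<gamma> \<beta> show ?R by blast
  next
    assume ?R
    then obtain P where \<gamma>: "1 \<le> \<gamma>" "\<gamma> \<le> int q" and P: "balanced A P (nat \<gamma>)" by blast
    define C where "C = {[x, y, z] | x y z. x \<in> A \<and> y \<in> A \<and> z \<in> A \<and> P x y z}"
    have mem: "[x, y, z] \<in> C \<longleftrightarrow> P x y z" if "x \<in> A" "y \<in> A" "z \<in> A" for x y z
      using that by (auto simp: C_def)
    have sub: "C \<subseteq> ?V" by (auto simp: C_def hamming_vertices_3)
    have N: "N C x y z = \<gamma> + int q * of_bool (P x y z)" if xyz: "x \<in> A" "y \<in> A" "z \<in> A" for x y z
    proof -
      have "N C x y z = int (card {u \<in> A. P u y z}) + int (card {u \<in> A. P x u z})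
          + int (card {u \<in> A. P x y u})"
        using xyz by (simp add: N_def mem cong: conj_cong)
      also have "\<dots> = int (nat \<gamma> + q * of_bool (P x y z))"
        unfolding cA[symmetric] balancedD[OF P xyz, symmetric] by simp
      finally show ?thesis using \<gamma> by simp
    qed
    from ne obtain x where x: "x \<in> A" by blast
    \<comment> \<open>The bounds on \<gamma> exclude the two trivial sets: the line sums of the
      empty set are 0 < \<gamma>, those of the whole space are 3q > \<gamma> + q.\<close>
    have "C \<noteq> {}"
    proof
      assume "C = {}"
      with N[OF x x x] mem[OF x x x] \<gamma> show False by (simp add: N_def)
    qed
    moreover have "C \<noteq> ?V"
    proof
      assume "C = ?V"
      then have "{u \<in> A. [u, x, x] \<in> C} = A" "{u \<in> A. [x, u, x] \<in> C} = A" "{u \<in> A. [x, x, u] \<in> C} = A"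
        "P x x x"
        using x mem[OF x x x] by (auto simp: hamming_vertices_3)
      with N[OF x x x] \<gamma> q cA show False by (simp add: N_def)
    qed
    moreover have "int (card {w \<in> ?V - C. hamming_adj 3 v w}) = 2 * int q - \<gamma>" if v: "v \<in> C" for v
    proof -
      from v obtain x y z where "v = [x, y, z]" "x \<in> A" "y \<in> A" "z \<in> A" "P x y z"
        unfolding C_def by blast
      with outC[OF sub, of x y z] N[of x y z] v show ?thesis by simp
    qed
    moreover have "int (card {w \<in> C. hamming_adj 3 v w}) = \<gamma>" if v: "v \<in> ?V - C" for v
    proof -
      from v obtain x y z where "v = [x, y, z]" "x \<in> A" "y \<in> A" "z \<in> A"
        unfolding hamming_vertices_3 by blast
      with inC[OF sub, of x y z] N[of x y z] v mem[of x y z] show ?thesis by simp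
    qed
    ultimately have "completely_regular_code_radius1 ?V (hamming_adj 3) C (2 * int q - \<gamma>) \<gamma>"
      using sub \<gamma> by (auto simp: completely_regular_code_radius1_def)
    with \<gamma> show ?L by (intro exI[of _ C] exI[of _ "2 * int q - \<gamma>"]) (simp add: eig)
  qed
qed

section \<open>Parity by summing over all vertices\<close>

lemma card_Collect_sum:
  assumes "finite A"
  shows "card {u \<in> A. P u} = (\<Sum>u\<in>A. of_bool (P u))"
  using assms by (simp add: of_bool_def sum.If_cases Collect_conj_eq Int_commute)

text \<open>Let \<open>S\<close> be the size of the code. After interchanging sums, each of the
  three line terms contributes q S, because one coordinate has become free. So 3 q S = q^3 g + q S,
  that is, 2 S = q^2 g.\<close>

lemma balanced_parity:
  assumes fin: "finite A" and ne: "A \<noteq> {}" and P: "balanced A P g"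
  shows "even g \<or> even (card A)"
proof -
  define f :: "'a \<Rightarrow> 'a \<Rightarrow> 'a \<Rightarrow> nat" where "f x y z = of_bool (P x y z)" for x y z
  define S where "S = (\<Sum>x\<in>A. \<Sum>y\<in>A. \<Sum>z\<in>A. f x y z)"
  let ?q = "card A"
  have bal: "(\<Sum>u\<in>A. f u y z) + (\<Sum>u\<in>A. f x u z) + (\<Sum>u\<in>A. f x y u) = g + ?q * f x y z"
    if "x \<in> A" "y \<in> A" "z \<in> A" for x y z
    using balancedD[OF P that] by (simp add: card_Collect_sum[OF fin] f_def)
  have "(\<Sum>x\<in>A. \<Sum>y\<in>A. \<Sum>z\<in>A. (\<Sum>u\<in>A. f u y z) + (\<Sum>u\<in>A. f x u z) + (\<Sum>u\<in>A. f x y u)) =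
      (\<Sum>x\<in>A. \<Sum>y\<in>A. \<Sum>z\<in>A. g + ?q * f x y z)"
    by (intro sum.cong refl bal)
  moreover have "(\<Sum>x\<in>A. \<Sum>y\<in>A. \<Sum>z\<in>A. \<Sum>u\<in>A. f u y z) = ?q * S"
  proof -
    have "(\<Sum>y\<in>A. \<Sum>z\<in>A. \<Sum>u\<in>A. f u y z) = (\<Sum>y\<in>A. \<Sum>u\<in>A. \<Sum>z\<in>A. f u y z)"
      by (intro sum.cong refl sum.swap)
    also have "\<dots> = S" unfolding S_def by (rule sum.swap)
    finally show ?thesis by simp
  qed
  moreover have "(\<Sum>x\<in>A. \<Sum>y\<in>A. \<Sum>z\<in>A. \<Sum>u\<in>A. f x u z) = ?q * S"
  proof -
    have "(\<Sum>z\<in>A. \<Sum>u\<in>A. f x u z) = (\<Sum>u\<in>A. \<Sum>z\<in>A. f x u z)" for x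
      by (rule sum.swap)
    then show ?thesis by (simp add: S_def sum_distrib_left)
  qed
  moreover have "(\<Sum>x\<in>A. \<Sum>y\<in>A. \<Sum>z\<in>A. \<Sum>u\<in>A. f x y u) = ?q * S"
    by (simp add: S_def sum_distrib_left)
  moreover have "(\<Sum>x\<in>A. \<Sum>y\<in>A. \<Sum>z\<in>A. g + ?q * f x y z) = ?q * (?q * (?q * g)) + ?q * S"
    by (simp add: S_def sum.distrib sum_distrib_left)
  ultimately have "?q * S + ?q * S + ?q * S = ?q * (?q * (?q * g)) + ?q * S"
    by (simp only: sum.distrib)
  then have "?q * S + ?q * S = ?q * (?q * (?q * g))"
    by simp
  then have "?q * (S + S) = ?q * (?q * (?q * g))"
    by (simp only: distrib_left)
  then have "S + S = ?q * (?q * g)"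
    using fin ne by (simp only: mult_cancel1 card_0_eq simp_thms)
  then have "even (?q * (?q * g))"
    by (metis even_add)
  then show ?thesis by auto
qed

section \<open>Condition 1 is necessary for odd \<gamma> below q/2\<close>

text \<open>Deleting the isolated vertices of the bipartite graph \<open>G\<close> leaves a
  biregular graph on \<open>Y\<close> and \<open>Z\<close> with degrees \<open>b\<close> and
  \<open>a\<close>. Counting its edges from both sides gives the equation; the neighbours of one
  vertex all lie in the opposite support, which gives the two bounds.\<close>

lemma double_counting_two_valued:
  fixes G :: "'a \<Rightarrow> 'b \<Rightarrow> bool"
  assumes fin: "finite A" "finite B"
    and row: "\<And>y. y \<in> A \<Longrightarrow> card {z \<in> B. G y z} \<in> {0, b}"
    and col: "\<And>z. z \<in> B \<Longrightarrow> card {y \<in> A. G y z} \<in> {0, a}"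
  defines "Y \<equiv> {y \<in> A. \<exists>z\<in>B. G y z}" and "Z \<equiv> {z \<in> B. \<exists>y\<in>A. G y z}"
  shows "b * card Y = a * card Z" "Y \<noteq> {} \<Longrightarrow> b \<le> card Z" "Y \<noteq> {} \<Longrightarrow> a \<le> card Y"
proof -
  have r: "card {z \<in> B. G y z} = b" if "y \<in> Y" for y
    using that row[of y] fin by (auto simp: Y_def)
  have c: "card {y \<in> A. G y z} = a" if "z \<in> Z" for z
    using that col[of z] fin by (auto simp: Z_def)
  have r': "card {z \<in> Z. G y z} = b" if "y \<in> Y" for y
  proof -
    have "{z \<in> Z. G y z} = {z \<in> B. G y z}" using that by (auto simp: Y_def Z_def)
    then show ?thesis using r[OF that] by simp
  qed
  have c': "card {y \<in> Y. G y z} = a" if "z \<in> Z" for z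
  proof -
    have "{y \<in> Y. G y z} = {y \<in> A. G y z}" using that by (auto simp: Y_def Z_def)
    then show ?thesis using c[OF that] by simp
  qed
  have fYZ: "finite Y" "finite Z" using fin by (auto simp: Y_def Z_def)
  have "b * card Y = (\<Sum>y\<in>Y. card {z \<in> Z. G y z})" by (simp add: r')
  also have "\<dots> = (\<Sum>z\<in>Z. card {y \<in> Y. G y z})"
    unfolding card_Collect_sum[OF fYZ(1)] card_Collect_sum[OF fYZ(2)] by (rule sum.swap)
  also have "\<dots> = a * card Z" by (simp add: c')
  finally show "b * card Y = a * card Z" .
  assume "Y \<noteq> {}"
  then obtain y z where "y \<in> Y" "z \<in> Z" by (auto simp: Y_def Z_def)
  with r' c' have "b = card {z \<in> Z. G y z}" "a = card {y \<in> Y. G y z}" by auto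
  with fYZ show "b \<le> card Z" "a \<le> card Y" by (auto intro!: card_mono)
qed

text \<open>The hypotheses are invariant under simultaneous permutations of the three coordinates, so
  each of the next two lemmas yields all three weights or parts.\<close>

lemma weight_pos:
  fixes a b c q :: nat
  assumes "c * x2 = a * z2" "c * x3 = b * y3" "b * y1 = a * z1"
    and "c \<noteq> 0 \<Longrightarrow> x2 + x3 = q" "b \<noteq> 0 \<Longrightarrow> y1 + y3 = q" "a \<noteq> 0 \<Longrightarrow> z1 + z2 = q"
    and "q > 0" "odd (a + b + c)"
  shows "c > 0"
proof (rule ccontr)
  assume "\<not> c > 0"
  then have c: "c = 0" by simp
  \<comment> \<open>If \<open>b\<close> is nonzero then \<open>y3 = 0\<close> and
    \<open>y1 = q\<close>; if \<open>a\<close> is nonzero then \<open>z2 = 0\<close> and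
    \<open>z1 = q\<close>. In every combination \<open>b * y1 = a * z1\<close> forces
    \<open>a = b\<close>, so the total weight is even.\<close>
  then have "b = 0 \<or> y3 = 0" "a = 0 \<or> z2 = 0" using assms by auto
  then have "a = b" using assms(3,5,6,7) by (cases "a = 0"; cases "b = 0") auto
  with c assms(8) show False by simp
qed

lemma part_pos:
  fixes a b c q :: nat
  assumes pos: "c > 0" "b > 0" "a > 0"
    and eq: "c * x2 = a * z2" "c * x3 = b * y3" "b * y1 = a * z1"
    and sums: "x2 + x3 = q" "y1 + y3 = q" "z1 + z2 = q"
    and q: "q > 0" "odd (a + b + c)"
  shows "y1 > 0"
proof (rule ccontr)
  assume "\<not> y1 > 0"
  then have "y3 = q" "z2 = q" using eq(3) pos sums by auto
  \<comment> \<open>The first two equations are added, using \<open>x2 + x3 = q\<close>; then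
    \<open>c = a + b\<close> makes the total weight even.\<close>
  then have "c * q = (a + b) * q"
    using eq(1,2) by (simp flip: sums(1) add: distrib_left distrib_right)
  with q(1) have "a + b + c = 2 * (a + b)" by simp
  with q(2) show False by (metis dvd_triv_left)
qed

text \<open>Here \<open>r = x2\<close>, \<open>s = y1\<close>, \<open>t = z1\<close>, while
  \<open>x3\<close>, \<open>y3\<close>, \<open>z2\<close> are the complementary sizes; naming these
  separately keeps all hypotheses free of subtraction.\<close>

lemma condition1I:
  fixes a b c q :: nat
  assumes "x2 + x3 = q" "y1 + y3 = q" "z1 + z2 = q"
    and "x2 > 0" "x3 > 0" "y1 > 0" "y3 > 0" "z1 > 0" "z2 > 0" "a > 0" "b > 0" "c > 0"
    and "c * x2 = a * z2" "c * x3 = b * y3" "b * y1 = a * z1"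
    and "b \<le> z1" "a \<le> y1" "c \<le> z2" "a \<le> x2" "c \<le> y3" "b \<le> x3"
  shows "condition1 q (int (a + b + c))"
proof -
  have e: "int q - int x2 = int x3" "int q - int y1 = int y3" "int q - int z1 = int z2"
    using assms(1-3) by linarith+
  show ?thesis
    unfolding condition1_def
  proof (rule exI[of _ "int x2"], rule exI[of _ "int y1"], rule exI[of _ "int z1"],
      rule exI[of _ "int a"], rule exI[of _ "int b"], rule exI[of _ "int c"], intro conjI)
  qed (use assms in \<open>simp_all add: e flip: of_nat_mult\<close>)
qed

lemma balanced_imp_condition1:
  assumes fin: "finite A" and P: "balanced A P g" and odd: "odd g" and small: "2 * g < card A"
  shows "condition1 (card A) (int g)"
proof -
  define q where "q = card A"
  from small have ne: "A \<noteq> {}" by auto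
  \<comment> \<open>The bases of the three cylinders: \<open>g1\<close>, \<open>g2\<close>,
    \<open>g3\<close> collect the lines contained in the code, and the digit names the free
    coordinate.\<close>
  define g1 where "g1 y z \<longleftrightarrow> (\<forall>u\<in>A. P u y z)" for y z
  define g2 where "g2 x z \<longleftrightarrow> (\<forall>u\<in>A. P x u z)" for x z
  define g3 where "g3 x y \<longleftrightarrow> (\<forall>u\<in>A. P x y u)" for x y
  note bal = balancedD[OF P, folded q_def]
  have full1: "card {u \<in> A. P u y z} = q" if "g1 y z" for y z
    unfolding q_def using that by (intro arg_cong[of _ _ card]) (auto simp: g1_def)
  have full2: "card {u \<in> A. P x u z} = q" if "g2 x z" for x z
    unfolding q_def using that by (intro arg_cong[of _ _ card]) (auto simp: g2_def)
  have full3: "card {u \<in> A. P x y u} = q" if "g3 x y" for x y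
    unfolding q_def using that by (intro arg_cong[of _ _ card]) (auto simp: g3_def)
  \<comment> \<open>A line that is not full contains a point outside the code, where the three line
    counts add up to just \<open>g\<close>.\<close>
  have part1: "card {u \<in> A. P u y z} \<le> g" if "\<not> g1 y z" "y \<in> A" "z \<in> A" for y z
  proof -
    from that obtain u where "u \<in> A" "\<not> P u y z" by (auto simp: g1_def)
    with bal[of u y z] that show ?thesis by simp
  qed
  have part2: "card {u \<in> A. P x u z} \<le> g" if "\<not> g2 x z" "x \<in> A" "z \<in> A" for x z
  proof -
    from that obtain u where "u \<in> A" "\<not> P x u z" by (auto simp: g2_def)
    with bal[of x u z] that show ?thesis by simp
  qed
  have part3: "card {u \<in> A. P x y u} \<le> g" if "\<not> g3 x y" "x \<in> A" "y \<in> A" for x y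
  proof -
    from that obtain u where "u \<in> A" "\<not> P x y u" by (auto simp: g3_def)
    with bal[of x y u] that show ?thesis by simp
  qed
  \<comment> \<open>Two full lines through one point would give a line sum of at least 2q, more than
    \<open>g + q\<close>.\<close>
  have dis12: "\<not> (g1 y z \<and> g2 x z)" and dis13: "\<not> (g1 y z \<and> g3 x y)"
    and dis23: "\<not> (g2 x z \<and> g3 x y)"
    if "x \<in> A" "y \<in> A" "z \<in> A" for x y z
    using bal[OF that] full1[of y z] full2[of x z] full3[of x y] small
    by (cases "P x y z"; fastforce simp: q_def)+
  \<comment> \<open>Without a full line the sum at a point of the code would be at most 3g, less
    than \<open>g + q\<close> because 2g < q.\<close>
  have cover: "g1 y z \<or> g2 x z \<or> g3 x y" if "x \<in> A" "y \<in> A" "z \<in> A" "P x y z" for x y z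
    using bal[OF that(1-3)] part1[OF _ that(2,3)] part2[OF _ that(1,3)] part3[OF _ that(1,2)]
      that(4) small unfolding q_def
    by fastforce
  have dec: "of_bool (P x y z) = (of_bool (g1 y z) + of_bool (g2 x z) + of_bool (g3 x y) :: nat)"
    if "x \<in> A" "y \<in> A" "z \<in> A" for x y z
    using cover[OF that] dis12[OF that] dis13[OF that] dis23[OF that] that
    by (auto simp: g1_def g2_def g3_def)
  \<comment> \<open>Line counts of the bases: the digit names the base, the letter the coordinate
    held fixed.\<close>
  define c1y c1z where "c1y y = card {z \<in> A. g1 y z}" and "c1z z = card {y \<in> A. g1 y z}" for y z
  define c2x c2z where "c2x x = card {z \<in> A. g2 x z}" and "c2z z = card {x \<in> A. g2 x z}" for x z
  define c3x c3y where "c3x x = card {y \<in> A. g3 x y}" and "c3y y = card {x \<in> A. g3 x y}" for x y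
  note c_defs = c1y_def c1z_def c2x_def c2z_def c3x_def c3y_def
  \<comment> \<open>By \<open>dec\<close>, the full lines contribute exactly
    \<open>q * of_bool (P x y z)\<close>, which cancels. The six remaining counts group by
    coordinate, so each group is constant in its own variable.\<close>
  have tot: "(c2x x + c3x x) + (c1y y + c3y y) + (c1z z + c2z z) = g"
    if "x \<in> A" "y \<in> A" "z \<in> A" for x y z
  proof -
    have "card {u \<in> A. P u y z} = q * of_bool (g1 y z) + c2z z + c3y y"
      using that by (simp add: card_Collect_sum[OF fin] c_defs dec sum.distrib q_def)
    moreover have "card {u \<in> A. P x u z} = c1z z + q * of_bool (g2 x z) + c3x x"
      using that by (simp add: card_Collect_sum[OF fin] c_defs dec sum.distrib q_def)
    moreover have "card {u \<in> A. P x y u} = c1y y + c2x x + q * of_bool (g3 x y)"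
      using that by (simp add: card_Collect_sum[OF fin] c_defs dec sum.distrib q_def)
    ultimately show ?thesis
      using bal[OF that] dec[OF that] by (simp add: algebra_simps)
  qed
  from ne obtain e where e: "e \<in> A" by blast
  define a b c where "a = c1z e + c2z e" and "b = c1y e + c3y e" and "c = c2x e + c3x e"
  have cx: "c2x x + c3x x = c" if "x \<in> A" for x
    using tot[OF that e e] tot[OF e e e] by (simp add: c_def)
  have by': "c1y y + c3y y = b" if "y \<in> A" for y
    using tot[OF e that e] tot[OF e e e] by (simp add: b_def)
  have az: "c1z z + c2z z = a" if "z \<in> A" for z
    using tot[OF e e that] tot[OF e e e] by (simp add: a_def)
  have g: "g = a + b + c" using tot[OF e e e] by (simp add: a_def b_def c_def)
  \<comment> \<open>If both counts were nonzero, some point with first coordinate \<open>x\<close>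
    would lie on two full lines. Hence each count is 0 or the constant of its coordinate.\<close>
  have zx: "c2x x = 0 \<or> c3x x = 0" if "x \<in> A" for x
    using that dis23 fin by (auto simp: c_defs)
  have zy: "c1y y = 0 \<or> c3y y = 0" if "y \<in> A" for y
    using that dis13 fin by (auto simp: c_defs)
  have zz: "c1z z = 0 \<or> c2z z = 0" if "z \<in> A" for z
    using that dis12 fin by (auto simp: c_defs)
  define X2 X3 where "X2 = {x \<in> A. \<exists>z\<in>A. g2 x z}" and "X3 = {x \<in> A. \<exists>y\<in>A. g3 x y}"
  define Y1 Y3 where "Y1 = {y \<in> A. \<exists>z\<in>A. g1 y z}" and "Y3 = {y \<in> A. \<exists>x\<in>A. g3 x y}"
  define Z1 Z2 where "Z1 = {z \<in> A. \<exists>y\<in>A. g1 y z}" and "Z2 = {z \<in> A. \<exists>x\<in>A. g2 x z}"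
  have vx: "c2x x \<in> {0, c}" "c3x x \<in> {0, c}" if "x \<in> A" for x
    using cx[OF that] zx[OF that] by auto
  have vy: "c1y y \<in> {0, b}" "c3y y \<in> {0, b}" if "y \<in> A" for y
    using by'[OF that] zy[OF that] by auto
  have vz: "c1z z \<in> {0, a}" "c2z z \<in> {0, a}" if "z \<in> A" for z
    using az[OF that] zz[OF that] by auto
  \<comment> \<open>Edge counts of the three bases give the three equations of Condition 1: b |Y1| =
    a |Z1|, c |X2| = a |Z2| and c |X3| = b |Y3|.\<close>
  note d1 = double_counting_two_valued[OF fin fin vy(1)[unfolded c1y_def] vz(1)[unfolded c1z_def],
      folded Y1_def Z1_def]
  note d2 = double_counting_two_valued[OF fin fin vx(1)[unfolded c2x_def] vz(2)[unfolded c2z_def],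
      folded X2_def Z2_def]
  note d3 = double_counting_two_valued[OF fin fin vx(2)[unfolded c3x_def] vy(2)[unfolded c3y_def],
      folded X3_def Y3_def]
  have mem: "x \<in> X2 \<longleftrightarrow> c2x x \<noteq> 0" "x \<in> X3 \<longleftrightarrow> c3x x \<noteq> 0"
    "x \<in> Y1 \<longleftrightarrow> c1y x \<noteq> 0" "x \<in> Y3 \<longleftrightarrow> c3y x \<noteq> 0"
    "x \<in> Z1 \<longleftrightarrow> c1z x \<noteq> 0" "x \<in> Z2 \<longleftrightarrow> c2z x \<noteq> 0" if "x \<in> A" for x
    using that fin by (auto simp: X2_def X3_def Y1_def Y3_def Z1_def Z2_def c_defs)
  have split: "card U + card W = q"
    if "U \<subseteq> A" "W \<subseteq> A" "\<And>x. x \<in> A \<Longrightarrow> x \<in> U \<longleftrightarrow> x \<notin> W" for U W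
  proof -
    have "card U + card W = card (U \<union> W)"
      using that fin by (intro card_Un_disjoint[symmetric]) (auto intro: finite_subset)
    also have "U \<union> W = A" using that by auto
    finally show ?thesis by (simp add: q_def)
  qed
  have sub: "X2 \<subseteq> A" "X3 \<subseteq> A" "Y1 \<subseteq> A" "Y3 \<subseteq> A" "Z1 \<subseteq> A" "Z2 \<subseteq> A"
    by (auto simp: X2_def X3_def Y1_def Y3_def Z1_def Z2_def)
  \<comment> \<open>When the constant is nonzero, exactly one of the two counts at each element is
    nonzero, so the two supports partition \<open>A\<close>.\<close>
  have sX: "card X2 + card X3 = q" if "c \<noteq> 0"
    using that cx zx by (intro split sub) (fastforce simp: mem)
  have sY: "card Y1 + card Y3 = q" if "b \<noteq> 0"
    using that by' zy by (intro split sub) (fastforce simp: mem)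
  have sZ: "card Z1 + card Z2 = q" if "a \<noteq> 0"
    using that az zz by (intro split sub) (fastforce simp: mem)
  have qpos: "q > 0" using small by (simp add: q_def)
  have odd': "odd (a + b + c)" "odd (a + c + b)" "odd (c + b + a)"
    using odd g by (simp_all add: ac_simps)
  note facts = d1(1) d2(1) d3(1) sX sY sZ qpos odd'
  have "c > 0"
    by (rule weight_pos[of c "card X2" a "card Z2" "card X3" b "card Y3" "card Y1" "card Z1" q])
      (use facts in simp_all)
  moreover have "b > 0"
    by (rule weight_pos[of b "card Y1" a "card Z1" "card Y3" c "card X3" "card X2" "card Z2" q])
      (use facts in simp_all)
  moreover have "a > 0"
    by (rule weight_pos[of a "card Z2" c "card X2" "card Z1" b "card Y1" "card Y3" "card X3" q])
      (use facts in simp_all)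
  ultimately have abc: "c > 0" "b > 0" "a > 0" by auto
  with sX sY sZ have sX: "card X2 + card X3 = q" and sY: "card Y1 + card Y3 = q"
    and sZ: "card Z1 + card Z2 = q"
    by auto
  note facts = abc d1(1) d2(1) d3(1) sX sY sZ qpos odd'
  have "card Y1 > 0"
    by (rule part_pos[of c b a "card X2" "card Z2" "card X3" "card Y3" "card Y1" "card Z1" q])
      (use facts in simp_all)
  moreover have "card X2 > 0"
    by (rule part_pos[of b c a "card Y1" "card Z1" "card Y3" "card X3" "card X2" "card Z2" q])
      (use facts in simp_all)
  moreover have "card Y3 > 0"
    by (rule part_pos[of a b c "card Z2" "card X2" "card Z1" "card Y1" "card Y3" "card X3" q])
      (use facts in simp_all)
  \<comment> \<open>Since the weights are positive, the edge counts carry positivity from one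
    support of each base to the other.\<close>
  moreover from calculation abc d1(1) d2(1) d3(1) have "card Z1 > 0" "card Z2 > 0" "card X3 > 0"
    by (metis gr0I less_not_refl mult_is_0)+
  moreover note abc g sX sY sZ
  moreover from calculation have "Y1 \<noteq> {}" "X2 \<noteq> {}" "X3 \<noteq> {}" by auto
  then have "b \<le> card Z1" "a \<le> card Y1" "c \<le> card Z2" "a \<le> card X2" "c \<le> card Y3" "b \<le> card X3"
    using d1 d2 d3 by auto
  moreover note d1(1) d2(1) d3(1)
  ultimately show ?thesis
    unfolding g q_def[symmetric]
    by (intro condition1I[of "card X2" "card X3" q "card Y1" "card Y3" "card Z1" "card Z2"]) auto
qed

section \<open>Biregular relations by cyclic filling\<close>

lemma mod_eq_imp_eq_nat:
  fixes k l n :: nat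
  assumes "k mod n = l mod n" "k < l + n" "l < k + n"
  shows "k = l"
  using assms
proof (induction k l rule: linorder_wlog)
  case (le k l)
  then have "n dvd l - k" using mod_eq_dvd_iff_nat[of k l n] by simp
  moreover have "l - k < n" using le by linarith
  ultimately have "l - k = 0" by (metis dvd_imp_le leD neq0_conv)
  with le show ?case by simp
qed auto

text \<open>At most \<open>n\<close> consecutive numbers have distinct residues modulo
  \<open>n\<close>.\<close>

lemma card_cyclic_row:
  fixes c n s :: nat
  assumes "c \<le> n"
  shows "card {j. j < n \<and> (\<exists>k<c. (s + k) mod n = j)} = c"
proof -
  have "{j. j < n \<and> (\<exists>k<c. (s + k) mod n = j)} = (\<lambda>k. (s + k) mod n) ` {..<c}"
    using assms by auto
  moreover have "inj_on (\<lambda>k. (s + k) mod n) {..<c}"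
  proof (rule inj_onI)
    fix k l assume "k \<in> {..<c}" "l \<in> {..<c}" "(s + k) mod n = (s + l) mod n"
    with assms mod_eq_imp_eq_nat[of "s + k" n "s + l"] show "k = l" by auto
  qed
  ultimately show ?thesis by (simp add: card_image)
qed

lemma card_residue_class:
  fixes a j n :: nat
  assumes "j < n"
  shows "card {l. l < n * a \<and> l mod n = j} = a"
proof -
  have "{l. l < n * a \<and> l mod n = j} = (\<lambda>i. n * i + j) ` {..<a}"
  proof (intro equalityI subsetI)
    fix l assume "l \<in> {l. l < n * a \<and> l mod n = j}"
    then have "l = n * (l div n) + j" "l div n < a"
      by (auto simp: div_less_iff_less_mult mult.commute assms less_mult_imp_div_less)
    then show "l \<in> (\<lambda>i. n * i + j) ` {..<a}" by blast
  next
    fix l assume "l \<in> (\<lambda>i. n * i + j) ` {..<a}"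
    then obtain i where i: "i < a" "l = n * i + j" by auto
    then have "n * Suc i \<le> n * a" by (intro mult_le_mono2) simp
    with i assms show "l \<in> {l. l < n * a \<and> l mod n = j}" by simp
  qed
  moreover have "inj_on (\<lambda>i. n * i + j) {..<a}"
    using assms by (auto simp: inj_on_def)
  ultimately show ?thesis by (simp add: card_image)
qed

text \<open>Row \<open>i\<close> uses the numbers from \<open>i * c\<close> up to
  \<open>i * c + c - 1\<close>, so the \<open>m\<close> rows together use each number below
  \<open>m * c = n * a\<close> once, and the residue \<open>j\<close> occurs \<open>a\<close> times
  among these. Since \<open>c \<le> n\<close>, no row contains it twice, and \<open>l div c\<close>
  recovers distinct rows.\<close>

lemma card_cyclic_column:
  fixes a c j m n :: nat
  assumes "c \<le> n" "m * c = n * a" "j < n"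
  shows "card {i. i < m \<and> (\<exists>k<c. (i * c + k) mod n = j)} = a"
proof -
  let ?L = "{l. l < n * a \<and> l mod n = j}"
  have "{i. i < m \<and> (\<exists>k<c. (i * c + k) mod n = j)} = (\<lambda>l. l div c) ` ?L"
  proof (intro equalityI subsetI)
    fix i assume "i \<in> {i. i < m \<and> (\<exists>k<c. (i * c + k) mod n = j)}"
    then obtain k where k: "i < m" "k < c" "(i * c + k) mod n = j" by auto
    have "Suc i * c \<le> m * c" using k(1) by (intro mult_le_mono1) simp
    with k have "i * c + k \<in> ?L" "(i * c + k) div c = i" by (auto simp flip: assms(2))
    then show "i \<in> (\<lambda>l. l div c) ` ?L" by force
  next
    fix i assume "i \<in> (\<lambda>l. l div c) ` ?L"
    then obtain l where l: "l < m * c" "l mod n = j" "i = l div c" by (auto simp: assms(2))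
    then have "c > 0" by (cases c) auto
    then have "i < m" "l mod c < c" "(i * c + l mod c) mod n = j"
      using l by (auto simp: less_mult_imp_div_less)
    then show "i \<in> {i. i < m \<and> (\<exists>k<c. (i * c + k) mod n = j)}" by blast
  qed
  moreover have "inj_on (\<lambda>l. l div c) ?L"
  proof (rule inj_onI)
    fix k l assume *: "k \<in> ?L" "l \<in> ?L" "k div c = l div c"
    then have "c > 0" by (cases c) (auto simp flip: assms(2))
    then have "k < c + l div c * c" "l < c + l div c * c"
      using dividend_less_div_times[of c k] dividend_less_div_times[of c l] *(3) by simp_all
    moreover have "l div c * c \<le> k" "l div c * c \<le> l"
      using div_times_less_eq_dividend[of k c] div_times_less_eq_dividend[of l c] *(3) by simp_all
    ultimately have "k < l + c" "l < k + c" by linarith+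
    with * assms(1) show "k = l" by (intro mod_eq_imp_eq_nat[of k n l]) auto
  qed
  ultimately show ?thesis
    using card_residue_class[OF assms(3), of a] by (simp add: card_image)
qed

lemma card_Collect_bij_betw:
  fixes n :: nat
  assumes "bij_betw h T {0..<n}"
  shows "card {y \<in> T. Q (h y)} = card {j. j < n \<and> Q j}"
proof -
  have "h ` T = {0..<n}" "inj_on h T" using assms by (auto simp: bij_betw_def)
  moreover have "h ` {y \<in> T. Q (h y)} = {j \<in> h ` T. Q j}" by auto
  moreover have "inj_on h {y \<in> T. Q (h y)}" using \<open>inj_on h T\<close> by (auto intro: inj_on_subset)
  ultimately show ?thesis
    using card_image[of h "{y \<in> T. Q (h y)}"] by simp
qed

lemma biregular_relation_exists:
  assumes fin: "finite S" "finite T" and eq: "card S * c = card T * a" and c: "c \<le> card T"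
  obtains R where "\<And>x. x \<in> S \<Longrightarrow> card {y \<in> T. R x y} = c"
    and "\<And>y. y \<in> T \<Longrightarrow> card {x \<in> S. R x y} = a"
proof -
  obtain f where f: "bij_betw f S {0..<card S}" using ex_bij_betw_finite_nat[OF fin(1)] by blast
  obtain h where h: "bij_betw h T {0..<card T}" using ex_bij_betw_finite_nat[OF fin(2)] by blast
  \<comment> \<open>With \<open>S\<close> and \<open>T\<close> numbered by \<open>f\<close> and
    \<open>h\<close>, each row gets \<open>c\<close> consecutive columns modulo
    \<open>card T\<close>, starting where the previous row stopped.\<close>
  show thesis
  proof (rule that[of "\<lambda>x y. \<exists>k<c. (f x * c + k) mod card T = h y"])
    fix x assume "x \<in> S"
    show "card {y \<in> T. \<exists>k<c. (f x * c + k) mod card T = h y} = c"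
      unfolding card_Collect_bij_betw[OF h, of "\<lambda>j. \<exists>k<c. (f x * c + k) mod card T = j"]
      by (rule card_cyclic_row[OF c])
  next
    fix y assume "y \<in> T"
    then have "h y < card T" using bij_betw_apply[OF h] by simp
    then show "card {x \<in> S. \<exists>k<c. (f x * c + k) mod card T = h y} = a"
      unfolding card_Collect_bij_betw[OF f, of "\<lambda>i. \<exists>k<c. (i * c + k) mod card T = h y"]
      by (rule card_cyclic_column[OF c eq])
  qed
qed

section \<open>Constructions of codes\<close>

text \<open>In a cylinder over an \<open>m\<close>-regular relation, lines along the axis are full
  or empty, and all other lines have \<open>m\<close> points.\<close>

lemma balanced_even:
  assumes fin: "finite A" and m: "m \<le> card A"
  shows "\<exists>P. balanced A P (2 * m)"
proof -
  obtain R where R: "\<And>x. x \<in> A \<Longrightarrow> card {y \<in> A. R x y} = m"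
    "\<And>y. y \<in> A \<Longrightarrow> card {x \<in> A. R x y} = m"
    using biregular_relation_exists[OF fin fin refl m] by blast
  then have "balanced A (\<lambda>x y z. R x y) (2 * m)"
    by (auto simp: balanced_def)
  then show ?thesis by blast
qed

text \<open>Used to count a line separately inside and outside a block, where the membership tests
  for that block are decided.\<close>

lemma card_Collect_split:
  assumes "finite A" "S \<subseteq> A"
  shows "card {u \<in> A. Q u} = card {u \<in> S. Q u} + card {u. u \<in> A \<and> u \<notin> S \<and> Q u}"
proof -
  have "{u \<in> A. Q u} = {u \<in> S. Q u} \<union> {u. u \<in> A \<and> u \<notin> S \<and> Q u}" using assms by auto
  then show ?thesis
    using assms by (simp only:) (intro card_Un_disjoint, auto intro: finite_subset)
qed

text \<open>Two boxes with complementary sides are joined to a cylinder over a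
  \<open>(g - p)\<close>-regular relation between \<open>Y\<close> and \<open>Z\<close>. A line that
  crosses both the region of the cylinder and a box has \<open>(g - p) + (2 * p - g) = p\<close>
  points, which is also the size of \<open>X\<close> and of its complement.\<close>

lemma balanced_half:
  assumes fin: "finite A" and cA: "card A = 2 * p" and g: "p \<le> g" "g \<le> 2 * p"
  shows "\<exists>P. balanced A P g"
proof -
  obtain X Y Z where X: "X \<subseteq> A" "card X = p" and Y: "Y \<subseteq> A" "card Y = g" and Z: "Z \<subseteq> A" "card Z = g"
    using obtain_subset_with_card_n[of p A] obtain_subset_with_card_n[of g A] cA g
    by (metis le_add1 mult_2)
  have fYZ: "finite Y" "finite Z" using Y Z fin by (auto intro: finite_subset)
  obtain R where R: "\<And>y. y \<in> Y \<Longrightarrow> card {z \<in> Z. R y z} = g - p"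
    "\<And>z. z \<in> Z \<Longrightarrow> card {y \<in> Y. R y z} = g - p"
    using biregular_relation_exists[OF fYZ, of "g - p" "g - p"] Y Z by auto
  define P where "P x y z \<longleftrightarrow> (x \<in> X \<and> y \<in> Y \<and> z \<notin> Z) \<or> (x \<notin> X \<and> y \<notin> Y \<and> z \<in> Z) \<or>
      (y \<in> Y \<and> z \<in> Z \<and> R y z)" for x y z
  have compl: "card {u. u \<in> A \<and> u \<notin> S} = 2 * p - card S" if "S \<subseteq> A" for S
    using card_Collect_split[OF fin that, of "\<lambda>_. True"] by (simp add: cA)
  note compl = compl[OF X(1)] compl[OF Y(1)] compl[OF Z(1)]
  have "balanced A P g"
    unfolding balanced_def
  proof (intro ballI)
    fix x y z assume "x \<in> A" "y \<in> A" "z \<in> A"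
    have "card {u \<in> A. P u y z} =
        (if y \<in> Y then if z \<in> Z then 2 * p * of_bool (R y z) else p else if z \<in> Z then p else 0)"
      by (subst card_Collect_split[OF fin X(1)])
        (simp add: P_def X compl cong: conj_cong)
    moreover have "card {u \<in> A. P x u z} =
        (if z \<in> Z then if x \<in> X then g - p else p else if x \<in> X then g else 0)"
      using g by (subst card_Collect_split[OF fin Y(1)])
        (simp add: P_def Y compl R cong: conj_cong)
    moreover have "card {u \<in> A. P x y u} =
        (if y \<in> Y then if x \<in> X then p else g - p else if x \<in> X then 0 else g)"
      using g by (subst card_Collect_split[OF fin Z(1)])
        (simp add: P_def Z compl R cong: conj_cong)
    ultimately show "card {u \<in> A. P u y z} + card {u \<in> A. P x u z} + card {u \<in> A. P x y u} =
        g + card A * of_bool (P x y z)"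
      using g by (simp add: P_def cA)
  qed
  then show ?thesis by blast
qed

text \<open>The cylinders stand over biregular relations on \<open>Y\<close> and \<open>Z\<close>,
  on \<open>X\<close> and \<open>A - Z\<close>, and on \<open>A - X\<close> and
  \<open>A - Y\<close>; any two are separated by one coordinate. Each value of a coordinate belongs
  to exactly one of the two bases involving that coordinate, with degree \<open>c\<close>,
  \<open>b\<close> or \<open>a\<close> for the first, second or third coordinate. So the partial
  lines always contribute \<open>a + b + c\<close>.\<close>

lemma balanced_three_blocks:
  assumes fin: "finite A" and sub: "X \<subseteq> A" "Y \<subseteq> A" "Z \<subseteq> A"
    and eq: "card Y * b = card Z * a" "card X * c = card (A - Z) * a"
      "card (A - X) * c = card (A - Y) * b"
    and le: "b \<le> card Z" "c \<le> card (A - Z)" "c \<le> card (A - Y)"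
  shows "\<exists>P. balanced A P (a + b + c)"
proof -
  have f: "finite X" "finite Y" "finite Z" "finite (A - X)" "finite (A - Y)" "finite (A - Z)"
    using fin sub by (auto intro: finite_subset)
  obtain R1 where R1: "\<And>y. y \<in> Y \<Longrightarrow> card {z \<in> Z. R1 y z} = b"
    "\<And>z. z \<in> Z \<Longrightarrow> card {y \<in> Y. R1 y z} = a"
    using biregular_relation_exists[OF f(2,3) eq(1) le(1)] by blast
  obtain R2 where R2: "\<And>x. x \<in> X \<Longrightarrow> card {z \<in> A - Z. R2 x z} = c"
    "\<And>z. z \<in> A - Z \<Longrightarrow> card {x \<in> X. R2 x z} = a"
    using biregular_relation_exists[OF f(1,6) eq(2) le(2)] by blast
  obtain R3 where R3: "\<And>x. x \<in> A - X \<Longrightarrow> card {y \<in> A - Y. R3 x y} = c"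
    "\<And>y. y \<in> A - Y \<Longrightarrow> card {x \<in> A - X. R3 x y} = b"
    using biregular_relation_exists[OF f(4,5) eq(3) le(3)] by blast
  note R = R1 R2[simplified] R3[simplified]
  define P where "P x y z \<longleftrightarrow> (y \<in> Y \<and> z \<in> Z \<and> R1 y z) \<or> (x \<in> X \<and> z \<notin> Z \<and> R2 x z) \<or>
      (x \<notin> X \<and> y \<notin> Y \<and> R3 x y)" for x y z
  have full: "card S + card {u. u \<in> A \<and> u \<notin> S} = card A" if "S \<subseteq> A" for S
    using card_Collect_split[OF fin that, of "\<lambda>_. True"] by simp
  note full = full[OF sub(1)] full[OF sub(2)] full[OF sub(3)]
  have "balanced A P (a + b + c)"
    unfolding balanced_def
  proof (intro ballI)
    fix x y z assume xyz: "x \<in> A" "y \<in> A" "z \<in> A"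
    have "card {u \<in> A. P u y z} = (if y \<in> Y \<and> z \<in> Z then card A * of_bool (R1 y z)
        else a * of_bool (z \<notin> Z) + b * of_bool (y \<notin> Y))"
      using xyz by (subst card_Collect_split[OF fin sub(1)])
        (simp add: P_def R full cong: conj_cong)
    moreover have "card {u \<in> A. P x u z} = (if x \<in> X \<and> z \<notin> Z then card A * of_bool (R2 x z)
        else a * of_bool (z \<in> Z) + c * of_bool (x \<notin> X))"
      using xyz by (subst card_Collect_split[OF fin sub(2)])
        (simp add: P_def R full cong: conj_cong)
    moreover have "card {u \<in> A. P x y u} = (if x \<notin> X \<and> y \<notin> Y then card A * of_bool (R3 x y)
        else b * of_bool (y \<in> Y) + c * of_bool (x \<in> X))"
      using xyz by (subst card_Collect_split[OF fin sub(3)])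
        (simp add: P_def R full cong: conj_cong)
    ultimately show "card {u \<in> A. P u y z} + card {u \<in> A. P x u z} + card {u \<in> A. P x y u} =
        a + b + c + card A * of_bool (P x y z)"
      by (simp add: P_def)
  qed
  then show ?thesis by blast
qed

text \<open>With \<open>r\<close>, \<open>s\<close>, \<open>t\<close> as the sizes of
  \<open>X\<close>, \<open>Y\<close>, \<open>Z\<close>, the equations of Condition 1 are the edge
  counts of the three relations.\<close>

lemma condition1_imp_balanced:
  assumes fin: "finite A" and c1: "condition1 (card A) (int g)"
  shows "\<exists>P. balanced A P g"
proof -
  let ?q = "card A"
  from c1 obtain r' s' t' a' b' c' :: int where
    *: "0 < r'" "r' < int ?q" "0 < s'" "s' < int ?q" "0 < t'" "t' < int ?q"
      "0 < c'" "c' \<le> int ?q - s'" "c' \<le> int ?q - t'" "0 < b'" "b' \<le> t'" "b' \<le> int ?q - r'"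
      "0 < a'" "a' \<le> r'" "a' \<le> s'"
      "c' * r' = a' * (int ?q - t')" "b' * (int ?q - s') = c' * (int ?q - r')" "a' * t' = b' * s'"
      "int g = a' + b' + c'"
    unfolding condition1_def min.bounded_iff by blast
  define r s t a b c where "r = nat r'" and "s = nat s'" and "t = nat t'"
    and "a = nat a'" and "b = nat b'" and "c = nat c'"
  have i: "r' = int r" "s' = int s" "t' = int t" "a' = int a" "b' = int b" "c' = int c"
    using * by (simp_all add: r_def s_def t_def a_def b_def c_def)
  note * = *[unfolded i]
  obtain X Y Z where X: "X \<subseteq> A" "card X = r" and Y: "Y \<subseteq> A" "card Y = s" and Z: "Z \<subseteq> A" "card Z = t"
    using * obtain_subset_with_card_n[of r A] obtain_subset_with_card_n[of s A]
      obtain_subset_with_card_n[of t A] by (metis nat_less_le of_nat_less_iff)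
  have compl: "int (card (A - S)) = int ?q - int (card S)" if "S \<subseteq> A" for S
    using that fin by (simp add: card_Diff_subset finite_subset of_nat_diff card_mono)
  note compl = compl[OF X(1), unfolded X] compl[OF Y(1), unfolded Y] compl[OF Z(1), unfolded Z]
  have "int (card Y * b) = int (card Z * a)" "int (card X * c) = int (card (A - Z) * a)"
    "int (card (A - X) * c) = int (card (A - Y) * b)"
    "int b \<le> int (card Z)" "int c \<le> int (card (A - Z))" "int c \<le> int (card (A - Y))"
    unfolding of_nat_mult compl unfolding X Y Z using * by (simp_all add: mult.commute)
  then have "\<exists>P. balanced A P (a + b + c)"
    by (intro balanced_three_blocks[OF fin X(1) Y(1) Z(1)]) (simp_all only: of_nat_eq_iff of_nat_le_iff)
  moreover have "a + b + c = g" using * by linarith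
  ultimately show ?thesis by simp
qed

section \<open>Assembling the characterisation\<close>

theorem theorem6:
  fixes A :: "'a set" and q :: nat and \<gamma> :: int
  assumes "q \<ge> 2" and "card A = q"
  shows "(\<exists>C \<beta>. completely_regular_code_radius1 (hamming_vertices 3 A) (hamming_adj 3) C \<beta> \<gamma> \<and>
            code_has_eigenvalue (hamming_vertices 3 A) (hamming_adj 3) \<beta> \<gamma>
              (hamming_eigenvalue 2 3 q) \<and>
            \<gamma> \<le> \<beta>)
     \<longleftrightarrow> (even \<gamma> \<and> 2 \<le> \<gamma> \<and> \<gamma> \<le> int q)
       \<or> (even q \<and> int q div 2 \<le> \<gamma> \<and> \<gamma> \<le> int q)
       \<or> (even q \<and> odd \<gamma> \<and> \<gamma> < int q div 2 \<and> condition1 q \<gamma>)"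
proof -
  have fin: "finite A" and ne: "A \<noteq> {}"
    using assms by (auto intro: card_ge_0_finite)
  define g where "g = nat \<gamma>"
  have "1 \<le> \<gamma> \<and> \<gamma> \<le> int q \<and> (\<exists>P. balanced A P g) \<longleftrightarrow>
      (even \<gamma> \<and> 2 \<le> \<gamma> \<and> \<gamma> \<le> int q)
       \<or> (even q \<and> int q div 2 \<le> \<gamma> \<and> \<gamma> \<le> int q)
       \<or> (even q \<and> odd \<gamma> \<and> \<gamma> < int q div 2 \<and> condition1 q \<gamma>)" (is "?L \<longleftrightarrow> ?R1 \<or> ?R2 \<or> ?R3")
  proof
    assume L: ?L
    then have \<gamma>: "\<gamma> = int g" by (simp add: g_def)
    from L obtain P where P: "balanced A P g" by blast
    show "?R1 \<or> ?R2 \<or> ?R3"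
    \<comment> \<open>An odd \<gamma> makes q even by parity. Thus the first case leads to
      alternative (1) or (2), and the second has odd \<gamma> with 2\<gamma> < q, which leads to
      (3).\<close>
    proof (cases "even \<gamma> \<or> int q div 2 \<le> \<gamma>")
      case True
      then show ?thesis
        using balanced_parity[OF fin ne P] L assms(2) \<gamma> by (auto elim!: evenE)
    next
      case False
      then have "odd g" "2 * g < card A" using \<gamma> assms(2) by auto
      with balanced_imp_condition1[OF fin P] balanced_parity[OF fin ne P] False \<gamma> assms(2)
      show ?thesis by auto
    qed
  next
    assume R: "?R1 \<or> ?R2 \<or> ?R3"
    then consider ?R1 | ?R2 | ?R3 by blast
    then show ?L
    proof cases
      case 1
      then obtain m where m: "\<gamma> = 2 * m" by blast
      with 1 have "g = 2 * nat m" "nat m \<le> card A" using assms(2) by (auto simp: g_def)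
      with 1 balanced_even[OF fin] show ?thesis by auto
    next
      case 2
      then obtain p where p: "q = 2 * p" by blast
      with 2 have "card A = 2 * p" "p \<le> g" "g \<le> 2 * p" using assms(2) by (auto simp: g_def)
      with 2 balanced_half[OF fin] p assms(1) show ?thesis by fastforce
    next
      case 3
      then have c1: "condition1 q \<gamma>" by blast
      then have "\<gamma> \<ge> 1" by (auto simp: condition1_def)
      with 3 condition1_imp_balanced[OF fin, of g] assms(2) show ?thesis by (auto simp: g_def)
    qed
  qed
  then show ?thesis
    using code_iff_balanced[OF assms] by (simp only: g_def)
qed

end
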